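(* Let $S=(a_1,\dots,a_n),(b_1,\dots,b_{n'})$ be a sequence of positive integers, let $\ell\ge 4$ be an integer, and let $F=F_E\cup F_N$ be a set of fixed edges and non-edges such that $F$ does not contain a cycle of length $2\ell$. Let $G=(V,U,E)$ and $G'=(V,U,E')$ be two different $F$-fixed realisations of $S$. Then there exist $F$-fixed realisations $G_1,\dots,G_k$ of $S$ with $G_1=G$, $G_k=G'$ such that (i) for every $1\le i<k$, $|G_i\triangle G_{i+1}|\le 2\ell-2$ and $G_i\triangle G_{i+1}$ corresponds to a $j$-swap of $G_i$ for some $j\le 2\ell-2$, and (ii) $k\le\frac12|G\triangle G'|$.
   Context: Let $V=\{v_1,\dots,v_n\}$ and $U=\{u_1,\dots,u_{n'}\}$ be disjoint finite vertex sets. $F_E$ and $F_N$ are sets of vertex pairs $\{v_i,u_j\}$ with $v_i\in V$, $u_j\in U$ (fixed edges and fixed non-edges), and $F=F_E\cup F_N$. The set $F$ is regarded as the edge set of a bipartite graph on $V\cup U$; "$F$ contains a cycle of length $2\ell$" means that this graph contains a cycle with $2\ell$ distinct vertices (not necessarily induced). An $F$-fixed realisation of $S$ is a labeled simple bipartite graph $G=(V,U,E)$ (all edges between $V$ and $U$) with $d_G(v_i)=a_i$ for all $v_i\in V$, $d_G(u_j)=b_j$ for all $u_j\in U$, $F_E\subseteq E$ and $F_N\cap E=\emptyset$. For realisations $G,G'$, $G\triangle G'$ denotes the symmetric difference $E(G)\triangle E(G')$ of the edge sets. An alternating cycle of $G$ is a cycle of vertex pairs from $V\times U$ whose pairs are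 alternately in $E(G)$ and not in $E(G)$. A $j$-swap of $G$ is the operation that takes an alternating cycle of $G$ of length $j$ with no repeated vertex, deletes from $G$ its pairs lying in $E(G)$, and adds its pairs not lying in $E(G)$. "$G_i\triangle G_{i+1}$ corresponds to a $j$-swap of $G_i$" means that $G_i\triangle G_{i+1}$ is the set of pairs of such an alternating cycle of $G_i$ of length $j$. *)

theory Defs
  imports Complex_Main
begin

definition pairs :: "'a set \<Rightarrow> 'a set \<Rightarrow> 'a set set" where
  "pairs V U = {{v, u} |v u. v \<in> V \<and> u \<in> U}"

definition degree :: "'a set set \<Rightarrow> 'a \<Rightarrow> nat" where
  "degree E x = card {e \<in> E. x \<in> e}"

text \<open>Graphs on the fixed vertex classes are given by their edge sets; the
  \<open>i\<close>-th vertex of \<open>vs\<close> (of \<open>us\<close>) has prescribed degree \<open>a ! i\<close> (\<open>b ! i\<close>).\<close>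

definition realisation ::
  "'a list \<Rightarrow> 'a list \<Rightarrow> nat list \<Rightarrow> nat list \<Rightarrow> 'a set set \<Rightarrow> 'a set set \<Rightarrow> 'a set set \<Rightarrow> bool" where
  "realisation vs us a b F\<^sub>E F\<^sub>N E \<longleftrightarrow>
     E \<subseteq> pairs (set vs) (set us) \<and>
     (\<forall>i<length vs. degree E (vs ! i) = a ! i) \<and>
     (\<forall>j<length us. degree E (us ! j) = b ! j) \<and>
     F\<^sub>E \<subseteq> E \<and> F\<^sub>N \<inter> E = {}"

text \<open>The \<open>i\<close>-th pair of the closed walk through the vertices \<open>cs\<close>; indices are cyclic.\<close>

definition cpair :: "'a list \<Rightarrow> nat \<Rightarrow> 'a set" where
  "cpair cs i = {cs ! (i mod length cs), cs ! (Suc i mod length cs)}"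

definition cycle_pairs :: "'a list \<Rightarrow> 'a set set" where
  "cycle_pairs cs = {cpair cs i |i. i < length cs}"

text \<open>The length bound excludes an edge traversed back and forth.\<close>

definition cycle_in :: "'a set set \<Rightarrow> 'a list \<Rightarrow> bool" where
  "cycle_in P cs \<longleftrightarrow> 3 \<le> length cs \<and> distinct cs \<and> cycle_pairs cs \<subseteq> P"

definition alternating_cycle :: "'a set \<Rightarrow> 'a set \<Rightarrow> 'a set set \<Rightarrow> 'a list \<Rightarrow> bool" where
  "alternating_cycle V U E cs \<longleftrightarrow>
     cycle_in (pairs V U) cs \<and>
     (\<forall>i<length cs. cpair cs i \<in> E \<longleftrightarrow> cpair cs (Suc i) \<notin> E)"

definition corresponds_to_swap ::
  "'a set \<Rightarrow> 'a set \<Rightarrow> nat \<Rightarrow> 'a set set \<Rightarrow> 'a set set \<Rightarrow> bool" where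
  "corresponds_to_swap V U j E D \<longleftrightarrow>
     (\<exists>cs. alternating_cycle V U E cs \<and> length cs = j \<and> D = cycle_pairs cs)"

end

theory Submission
  imports Defs
begin

text \<open>Since the realisations have equal degrees, an alternating walk inside the symmetric difference
  never gets stuck, so it closes up to an alternating cycle without repeated vertices; the symmetric
  difference is thus exhausted by edge-disjoint alternating cycles. A cycle of length at most
  \<open>2l - 2\<close> is a swap. A longer one has a chord outside \<open>F\<close>: otherwise \<open>F\<close> contains the bipartite
  complement of a path on \<open>2l\<close> vertices, which has a Hamiltonian cycle as \<open>l \<ge> 4\<close>. Such a chord
  splits the alternating cycle into two shorter ones, exactly one of which is alternating at once,
  while the other becomes so after the first has been swapped. By induction a cycle of length \<open>2m\<close>
  costs at most \<open>m - 1\<close> steps.\<close>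

section \<open>Alternating cycles and their pairs\<close>

text \<open>The flag \<open>s\<close> records the phase: whether the pair at index 0 lies in
  \<open>E\<close>. Membership thus depends only on the parity of the index and can be checked pair
  by pair when a cycle is cut into two.\<close>

definition alt_cycle :: "'a set \<Rightarrow> 'a set \<Rightarrow> bool \<Rightarrow> 'a set set \<Rightarrow> 'a list \<Rightarrow> bool" where
  "alt_cycle V U s E cs \<longleftrightarrow> even (length cs) \<and> 4 \<le> length cs \<and> distinct cs \<and>
     (\<forall>i<length cs. cpair cs i \<in> pairs V U \<and> (cpair cs i \<in> E \<longleftrightarrow> even i = s))"

lemma cpair_eq:
  assumes "i < length cs"
  shows "cpair cs i = {cs ! i, cs ! (if Suc i = length cs then 0 else Suc i)}"
  using assms by (simp add: cpair_def)

lemma cycle_pairs_image: "cycle_pairs cs = cpair cs ` {..<length cs}"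
  by (auto simp: cycle_pairs_def)

text \<open>Two equal pairs at different indices would make each index the cyclic successor of the
  other, which forces length 2.\<close>

lemma cpair_inj_on:
  assumes "distinct cs" "3 \<le> length cs"
  shows "inj_on (cpair cs) {..<length cs}"
proof (rule inj_onI)
  fix i j assume "i \<in> {..<length cs}" "j \<in> {..<length cs}" and eq: "cpair cs i = cpair cs j"
  then have ij: "i < length cs" "j < length cs" by auto
  define i' where "i' = (if Suc i = length cs then 0 else Suc i)"
  define j' where "j' = (if Suc j = length cs then 0 else Suc j)"
  have ij': "i' < length cs" "j' < length cs" using ij by (auto simp: i'_def j'_def)
  have "{cs ! i, cs ! i'} = {cs ! j, cs ! j'}"
    using eq ij by (simp add: cpair_eq i'_def j'_def)
  then have "i = j \<or> (i = j' \<and> i' = j)"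
    using ij ij' assms(1) by (auto simp: doubleton_eq_iff nth_eq_iff_index_eq)
  then show "i = j" using ij assms(2) by (auto simp: i'_def j'_def split: if_splits)
qed

lemma card_cycle_pairs:
  assumes "distinct cs" "3 \<le> length cs"
  shows "card (cycle_pairs cs) = length cs"
  using card_image[OF cpair_inj_on[OF assms]] by (simp add: cycle_pairs_image)

text \<open>Only the wrap-around needs care: the length is even, so the last index is odd, while its
  cyclic successor is 0.\<close>

lemma alternating_cycle_if_alt_cycle:
  assumes "alt_cycle V U s E cs"
  shows "alternating_cycle V U E cs"
proof -
  have "cpair cs i \<in> E \<longleftrightarrow> cpair cs (Suc i) \<notin> E" if i: "i < length cs" for i
  proof (cases "Suc i = length cs")
    case True
    have "4 \<le> length cs" using assms by (simp add: alt_cycle_def)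
    then have "cpair cs (Suc i) = cpair cs 0" using True by (simp add: cpair_def mod_Suc)
    moreover have "odd i" using assms True by (metis alt_cycle_def even_Suc)
    moreover have "cpair cs 0 \<in> E \<longleftrightarrow> s" using assms i by (fastforce simp: alt_cycle_def)
    ultimately show ?thesis using assms i by (auto simp: alt_cycle_def)
  next
    case False
    then have "Suc i < length cs" using i by simp
    then show ?thesis using assms i by (auto simp: alt_cycle_def)
  qed
  then show ?thesis
    using assms by (auto simp: alternating_cycle_def cycle_in_def alt_cycle_def cycle_pairs_def)
qed

section \<open>The two vertex classes along a cycle\<close>

lemma pairs_opposite:
  assumes "V \<inter> U = {}" "{x, y} \<in> pairs V U"
  shows "x \<in> V \<union> U" "x \<in> V \<longleftrightarrow> y \<notin> V"
  using assms by (auto simp: pairs_def doubleton_eq_iff)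

lemma pairs_insertI:
  assumes "x \<in> V \<union> U" "y \<in> V \<union> U" "x \<in> V \<longleftrightarrow> y \<notin> V"
  shows "{x, y} \<in> pairs V U"
proof (cases "x \<in> V")
  case True
  then show ?thesis using assms by (auto simp: pairs_def)
next
  case False
  then have "y \<in> V" "x \<in> U" using assms by auto
  then show ?thesis by (auto simp: pairs_def insert_commute)
qed

text \<open>Every pair of the cycle crosses between the classes, so the class of a vertex is
  determined by the parity of its index.\<close>

lemma alt_cycle_nth_side:
  assumes "V \<inter> U = {}" "alt_cycle V U s E cs" "i < length cs"
  shows "cs ! i \<in> V \<union> U \<and> (cs ! i \<in> V \<longleftrightarrow> even i = (cs ! 0 \<in> V))"
  using assms(3)
proof (induction i)
  case 0
  then have "cpair cs 0 \<in> pairs V U" using assms by (auto simp: alt_cycle_def)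
  then show ?case using pairs_opposite(1)[OF assms(1)] 0 by (auto simp: cpair_eq)
next
  case (Suc i)
  then have "cpair cs i \<in> pairs V U" "cpair cs (Suc i) \<in> pairs V U"
    using assms by (auto simp: alt_cycle_def)
  then have "{cs ! i, cs ! Suc i} \<in> pairs V U" "cs ! Suc i \<in> V \<union> U"
    using pairs_opposite(1)[OF assms(1)] Suc.prems by (auto simp: cpair_eq)
  then show ?case using pairs_opposite(2)[OF assms(1)] Suc by auto
qed

lemma alt_cycle_chord_in_pairs:
  assumes "V \<inter> U = {}" "alt_cycle V U s E cs" "i < length cs" "j < length cs" "even i \<noteq> even j"
  shows "{cs ! i, cs ! j} \<in> pairs V U"
  using alt_cycle_nth_side[OF assms(1,2,3)] alt_cycle_nth_side[OF assms(1,2,4)] assms(5)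
  by (intro pairs_insertI) auto

lemma finite_pairs:
  assumes "finite V" "finite U"
  shows "finite (pairs V U)"
proof -
  have "pairs V U = (\<lambda>(v, u). {v, u}) ` (V \<times> U)" by (auto simp: pairs_def)
  then show ?thesis using assms by simp
qed

section \<open>Swaps preserve degrees and realisations\<close>

text \<open>Only the pairs at index \<open>p\<close> and at its cyclic predecessor meet this vertex;
  their indices differ in parity, also across the wrap-around because the length is even.\<close>

lemma alt_cycle_incident:
  assumes "alt_cycle V U s E cs" "p < length cs"
  shows "\<exists>e f. {e \<in> cycle_pairs cs. cs ! p \<in> e} = {e, f} \<and> e \<in> E \<and> f \<notin> E"
proof -
  define q where "q = (if p = 0 then length cs - 1 else p - 1)"
  have q: "q < length cs" using assms(2) by (auto simp: q_def)
  have d: "distinct cs" and len: "4 \<le> length cs" "even (length cs)"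
    using assms by (auto simp: alt_cycle_def)
  have "cs ! p \<in> cpair cs i \<longleftrightarrow> i = p \<or> i = q" if "i < length cs" for i
    using that assms(2) d len by (auto simp: cpair_eq q_def nth_eq_iff_index_eq split: if_splits)
  then have inc: "{e \<in> cycle_pairs cs. cs ! p \<in> e} = {cpair cs p, cpair cs q}"
    using assms(2) q by (auto simp: cycle_pairs_image)
  have "even p \<noteq> even q" using assms(2) len by (cases "p = 0") (auto simp: q_def)
  then have "cpair cs p \<in> E \<longleftrightarrow> cpair cs q \<notin> E"
    using assms q by (auto simp: alt_cycle_def)
  then show ?thesis using inc insert_commute by metis
qed

text \<open>At a vertex of the cycle exactly one pair is deleted and one is added; at any other
  vertex nothing changes.\<close>

lemma degree_swap:
  assumes "alt_cycle V U s E cs" "finite E"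
  shows "degree (sym_diff E (cycle_pairs cs)) x = degree E x"
proof -
  let ?I = "\<lambda>A. {e \<in> A. x \<in> e}" and ?C = "cycle_pairs cs"
  have fC: "finite ?C" by (simp add: cycle_pairs_image)
  have "card (?I (?C - E)) = card (?I (E \<inter> ?C))"
  proof (cases "x \<in> set cs")
    case True
    then obtain e f where ef: "?I ?C = {e, f}" "e \<in> E" "f \<notin> E"
      using alt_cycle_incident[OF assms(1)] by (metis in_set_conv_nth)
    have "?I (?C - E) = ?I ?C - E" "?I (E \<inter> ?C) = ?I ?C \<inter> E" by auto
    then have "?I (?C - E) = {f}" "?I (E \<inter> ?C) = {e}" unfolding ef(1) using ef(2,3) by auto
    then show ?thesis by simp
  next
    case False
    have "x \<notin> cpair cs i" if "i < length cs" for i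
    proof -
      have "cpair cs i \<subseteq> set cs" using that by (auto simp: cpair_eq intro!: nth_mem)
      then show ?thesis using False by blast
    qed
    then have "?I ?C = {}" by (auto simp: cycle_pairs_image)
    then have "?I (?C - E) = {}" "?I (E \<inter> ?C) = {}" by blast+
    then show ?thesis by (simp only:)
  qed
  moreover have "card (?I (sym_diff E ?C)) = card (?I (E - ?C)) + card (?I (?C - E))"
  proof -
    have "?I (sym_diff E ?C) = ?I (E - ?C) \<union> ?I (?C - E)" by blast
    then show ?thesis using assms(2) fC by (simp only:) (rule card_Un_disjoint; auto)
  qed
  moreover have "card (?I E) = card (?I (E - ?C)) + card (?I (E \<inter> ?C))"
  proof -
    have "?I E = ?I (E - ?C) \<union> ?I (E \<inter> ?C)" by blast
    then show ?thesis using assms(2) by (simp only:) (rule card_Un_disjoint; auto)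
  qed
  ultimately show ?thesis by (simp add: degree_def)
qed

lemma realisation_swap:
  assumes "realisation vs us a b F\<^sub>E F\<^sub>N E" "alt_cycle (set vs) (set us) s E cs"
    and "cycle_pairs cs \<inter> (F\<^sub>E \<union> F\<^sub>N) = {}"
  shows "realisation vs us a b F\<^sub>E F\<^sub>N (sym_diff E (cycle_pairs cs))"
proof -
  have "E \<subseteq> pairs (set vs) (set us)" using assms(1) by (simp add: realisation_def)
  then have "finite E" using finite_subset finite_pairs by blast
  note deg = degree_swap[OF assms(2) this]
  have "cycle_pairs cs \<subseteq> pairs (set vs) (set us)"
    using assms(2) by (auto simp: alt_cycle_def cycle_pairs_image)
  then show ?thesis
    using assms(1,3) unfolding realisation_def deg by auto
qed

section \<open>Alternating cycles in the symmetric difference\<close>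

text \<open>Otherwise the pairs of \<open>B\<close> at \<open>x\<close> would form a proper subset
  of those of \<open>A\<close>, against the equal degrees.\<close>

lemma incident_exchange:
  assumes "degree A x = degree B x" "finite A" "e \<in> A - B" "x \<in> e"
  shows "\<exists>e\<in>B - A. x \<in> e"
proof (rule ccontr)
  assume "\<not> ?thesis"
  with assms(3,4) have "{e \<in> B. x \<in> e} \<subset> {e \<in> A. x \<in> e}" by blast
  from psubset_card_mono[OF _ this] show False using assms(1,2) by (simp add: degree_def)
qed

lemma alternating_walk:
  assumes "finite V" "finite U" "G \<subseteq> pairs V U" "G' \<subseteq> pairs V U" "G \<noteq> G'"
    and deg: "\<And>x. x \<in> V \<union> U \<Longrightarrow> degree G x = degree G' x"
  obtains w :: "nat \<Rightarrow> 'a"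
  where "\<And>n. {w n, w (Suc n)} \<in> (if even n then G - G' else G' - G)"
proof -
  have fin: "finite G" "finite G'" using assms finite_pairs finite_subset by blast+
  define S where "S n = (if even n then G - G' else G' - G)" for n :: nat
  have dbl: "\<exists>y. e = {x, y} \<and> x \<in> V \<union> U" if "e \<in> S n" "x \<in> e" for e x n
    using that assms(3,4) by (auto simp: S_def pairs_def split: if_splits)
  \<comment> \<open>Equal degrees let the walk leave \<open>x\<close> through a pair of the other
    kind, so it never gets stuck.\<close>
  have next_pair: "\<exists>f\<in>S (Suc n). x \<in> f" if "e \<in> S n" "x \<in> e" for e x n
  proof -
    have "degree G x = degree G' x" using dbl[OF that] deg by blast
    then show ?thesis
      using that fin incident_exchange[of G x G' e] incident_exchange[of G' x G e]
      by (cases "even n") (auto simp: S_def)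
  qed
  \<comment> \<open>The walk must begin in \<open>G - G'\<close>. This set is nonempty: a pair of
    \<open>G' - G\<close> would produce one of \<open>G - G'\<close> by
    \<open>next_pair\<close>.\<close>
  have "\<exists>x. \<exists>e\<in>S 0. x \<in> e"
  proof (cases "S 0 = {}")
    case True
    then obtain e where e: "e \<in> S 1" using assms(5) by (auto simp: S_def)
    then obtain x where "x \<in> e" using assms(4) by (auto simp: S_def pairs_def)
    with e next_pair[of e 1 x] True show ?thesis by (auto simp: S_def)
  next
    case False
    then obtain e where e: "e \<in> S 0" by auto
    then obtain x where "x \<in> e" using assms(3) by (auto simp: S_def pairs_def)
    with e show ?thesis by auto
  qed
  \<comment> \<open>The invariant for dependent choice: the current vertex lies on a pair of the
    kind to be used next.\<close>
  moreover have "\<exists>y. (\<exists>e\<in>S (Suc n). y \<in> e) \<and> {x, y} \<in> S n" if "\<exists>e\<in>S n. x \<in> e" for x n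
    using that dbl next_pair by (metis insertCI)
  ultimately have "\<exists>w. \<forall>n. (\<exists>e\<in>S n. w n \<in> e) \<and> {w n, w (Suc n)} \<in> S n"
    by (rule dependent_nat_choice)
  then show ?thesis using that by (auto simp: S_def)
qed

text \<open>The walk stays in a finite vertex set, so it repeats a vertex; the stretch up to the
  first repetition is the required cycle.\<close>

lemma alt_cycle_in_sym_diff:
  assumes disj: "V \<inter> U = {}" and "finite V" "finite U"
    and G: "G \<subseteq> pairs V U" "G' \<subseteq> pairs V U" and "G \<noteq> G'"
    and "\<And>x. x \<in> V \<union> U \<Longrightarrow> degree G x = degree G' x"
  obtains s cs where "alt_cycle V U s G cs" "cycle_pairs cs \<subseteq> sym_diff G G'"
proof -
  obtain w :: "nat \<Rightarrow> 'a" where w: "\<And>n. {w n, w (Suc n)} \<in> (if even n then G - G' else G' - G)"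
    using alternating_walk[OF assms(2-7)] by blast
  have wp: "{w n, w (Suc n)} \<in> pairs V U" for n
    using w[of n] G by (auto split: if_splits)
  have side: "w n \<in> V \<longleftrightarrow> even n = (w 0 \<in> V)" for n
  proof (induction n)
    case (Suc n)
    then show ?case using pairs_opposite(2)[OF disj wp[of n]] by auto
  qed simp
  have "range w \<subseteq> V \<union> U" using pairs_opposite(1)[OF disj wp] by auto
  then have "finite (range w)" using assms(2,3) by (meson finite_UnI finite_subset)
  then have "\<not> inj w" using finite_imageD infinite_UNIV_nat by blast
  then have ex: "\<exists>j. \<exists>i<j. w i = w j" by (metis injI linorder_neqE_nat)
  \<comment> \<open>Minimality of \<open>j\<close> makes all earlier vertices distinct, so the
    stretch from \<open>i\<close> to \<open>j\<close> has no repeated vertex.\<close>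
  define j where "j = (LEAST j. \<exists>i<j. w i = w j)"
  obtain i where i: "i < j" "w i = w j" using LeastI_ex[OF ex] by (auto simp: j_def)
  have "\<not> (\<exists>i<k. w i = w k)" if "k < j" for k using not_less_Least that by (auto simp: j_def)
  then have inj: "inj_on w {..<j}" by (metis inj_onI lessThan_iff linorder_neqE_nat)
  have par: "even i = even j" using i side[of i] side[of j] by auto
  \<comment> \<open>Going back and forth along one pair would put it in both \<open>G - G'\<close>
    and \<open>G' - G\<close>. With the parity this leaves length at least 4.\<close>
  have "j \<noteq> i + 2"
  proof
    assume "j = i + 2"
    then have "{w (Suc i), w (Suc (Suc i))} = {w i, w (Suc i)}" using i by auto
    then show False using w[of i] w[of "Suc i"] by (auto split: if_splits)
  qed
  then have len: "even (j - i)" "4 \<le> j - i" using par i(1) by presburger+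
  define cs where "cs = map w [i..<j]"
  \<comment> \<open>The closing pair agrees with the walk because \<open>w j = w i\<close>.\<close>
  have cp: "cpair cs k = {w (i + k), w (Suc (i + k))}" if "k < length cs" for k
  proof (cases "Suc k = length cs")
    case True
    then have "Suc (i + k) = j" using that by (simp add: cs_def)
    then show ?thesis using that True i by (auto simp: cpair_eq cs_def)
  qed (use that in \<open>auto simp: cpair_eq cs_def\<close>)
  have "distinct cs" using inj by (auto simp: cs_def distinct_map intro: inj_on_subset)
  moreover have "cpair cs k \<in> G \<longleftrightarrow> even k = even i" if "k < length cs" for k
    using w[of "i + k"] cp[OF that] by (auto split: if_splits)
  ultimately have "alt_cycle V U (even i) G cs"
    using len wp cp by (auto simp: alt_cycle_def cs_def)
  moreover have "cpair cs k \<in> sym_diff G G'" if "k < length cs" for k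
    using w[of "i + k"] cp[OF that] by (auto split: if_splits)
  then have "cycle_pairs cs \<subseteq> sym_diff G G'" by (auto simp: cycle_pairs_image)
  ultimately show ?thesis using that by blast
qed

section \<open>Chords of long alternating cycles\<close>

text \<open>The indices \<open>0, 5, 2, 7, 4, \<dots>\<close> modulo \<open>2l\<close> run through all of \<open>0, \<dots>, 2l - 1\<close> in steps of
  \<open>5\<close> and \<open>-3\<close>, which are chords as \<open>2l \<ge> 8\<close>.\<close>

lemma chords_cycle:
  assumes "distinct cs" "4 \<le> l" "2 * l \<le> length cs"
    and chords: "\<And>i j. i < j \<Longrightarrow> j < length cs \<Longrightarrow> odd (j - i) \<Longrightarrow> 3 \<le> j - i \<Longrightarrow>
      j - i + 3 \<le> length cs \<Longrightarrow> {cs ! i, cs ! j} \<in> F"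
  shows "\<exists>ds. cycle_in F ds \<and> length ds = 2 * l"
proof -
  \<comment> \<open>Even indices stay and odd ones rotate by 4 modulo \<open>2 * l\<close>; parity
    is preserved, so injectivity can be checked on each parity class separately.\<close>
  define p where "p k = (if even k then k else if k + 4 < 2 * l then k + 4 else k + 4 - 2 * l)" for k
  define ds where "ds = map (\<lambda>k. cs ! p k) [0..<2 * l]"
  have p: "p k < 2 * l" if "k < 2 * l" for k using that assms(2) by (auto simp: p_def)
  have par: "even (p k) = even k" for k by (auto simp: p_def)
  have "inj_on p {..<2 * l}"
  proof (rule inj_onI)
    fix x y assume "x \<in> {..<2 * l}" "y \<in> {..<2 * l}" "p x = p y"
    moreover from this have "even x = even y" using par[of x] par[of y] by simp
    ultimately show "x = y" by (cases "even x") (auto simp: p_def split: if_splits)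
  qed
  moreover have "inj_on ((!) cs) (p ` {..<2 * l})"
    using p assms(1,3) by (intro inj_on_nth) force+
  ultimately have "inj_on (\<lambda>k. cs ! p k) {..<2 * l}"
    using comp_inj_on by (fastforce simp: comp_def)
  then have "distinct ds" by (simp add: ds_def distinct_map atLeast0LessThan)
  have chord: "{cs ! x, cs ! y} \<in> F"
    if "x < 2 * l" "y < 2 * l" "even x \<noteq> even y" "x + 3 \<le> y \<or> y + 3 \<le> x"
      "x + 3 \<le> y + 2 * l" "y + 3 \<le> x + 2 * l" for x y
  proof -
    \<comment> \<open>Only the first \<open>2 * l\<close> vertices are used, and the distance bound
      relative to \<open>2 * l\<close> implies the one relative to \<open>length cs\<close>.\<close>
    have *: "{cs ! x, cs ! y} \<in> F"
      if "x + 3 \<le> y" "y < 2 * l" "even x \<noteq> even y" "y + 3 \<le> x + 2 * l" for x y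
      using that assms(3) by (intro chords) auto
    show ?thesis using that *[of x y] *[of y x] by (auto simp: insert_commute)
  qed
  have "cpair ds k \<in> F" if k: "k < 2 * l" for k
  proof -
    define k' where "k' = (if Suc k = 2 * l then 0 else Suc k)"
    have "Suc k = 2 * l \<longrightarrow> odd k" by presburger
    have k': "k' < 2 * l" "even k' \<noteq> even k" using k by (auto simp: k'_def) presburger+
    have "cpair ds k = {cs ! p k, cs ! p k'}"
      using k k' by (auto simp: cpair_eq ds_def k'_def)
    moreover have "p k + 3 \<le> p k' \<or> p k' + 3 \<le> p k"
      using k \<open>Suc k = 2 * l \<longrightarrow> odd k\<close> assms(2) by (auto simp: p_def k'_def)
    moreover have "p k + 3 \<le> p k' + 2 * l" "p k' + 3 \<le> p k + 2 * l"
      using k \<open>Suc k = 2 * l \<longrightarrow> odd k\<close> assms(2) by (auto simp: p_def k'_def)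
    ultimately show ?thesis using chord[of "p k" "p k'"] p k k' par by auto
  qed
  then have "cycle_in F ds"
    using \<open>distinct ds\<close> assms(2) by (auto simp: cycle_in_def cycle_pairs_image ds_def)
  then show ?thesis by (auto simp: ds_def)
qed

section \<open>Splitting an alternating cycle along a chord\<close>

text \<open>The chord closes each of the two arcs between \<open>i\<close> and \<open>j\<close> to a
  cycle. One of these alternates only if the chord is in \<open>E\<close>, the other only if it is
  not; swapping the right one first flips the chord and makes the other alternate. In the conclusion
  \<open>A\<close> is the cycle swapped first, whichever arc it comes from.\<close>

lemma split_alt_cycle:
  assumes alt: "alt_cycle V U s E cs" and "V \<inter> U = {}"
    and ij: "i < j" "j < length cs" "odd (j - i)" "3 \<le> j - i" "j - i + 3 \<le> length cs"
  obtains A B s\<^sub>A s\<^sub>B where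
    "alt_cycle V U s\<^sub>A E A" "alt_cycle V U s\<^sub>B (sym_diff E (cycle_pairs A)) B"
    "length A < length cs" "length B < length cs" "length A + length B = length cs + 2"
    "cycle_pairs A \<union> cycle_pairs B = insert {cs ! i, cs ! j} (cycle_pairs cs)"
    "sym_diff (cycle_pairs A) (cycle_pairs B) = cycle_pairs cs"
proof -
  \<comment> \<open>Here \<open>c\<close> counts the vertices strictly between \<open>i\<close> and
    \<open>j\<close>, and \<open>r\<close> below counts those from \<open>j\<close> to the end.
    Writing lengths as sums avoids truncated subtraction.\<close>
  obtain c where c: "j = i + Suc c" "even c" "2 \<le> c"
    using ij by (intro that[of "j - i - 1"]) auto
  obtain r where r: "length cs = i + Suc c + r" "0 < r" "3 \<le> i + r"
    using ij c by (intro that[of "length cs - j"]) auto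
  have even_len: "even (i + Suc c + r)" using alt unfolding alt_cycle_def r(1) by blast
  define n where "n = i + Suc c + r"
  have n: "length cs = n" using r by (simp add: n_def)
  define e where "e = {cs ! i, cs ! j}"
  define A where "A = map (\<lambda>k. cs ! (i + k)) [0..<Suc (Suc c)]"
  \<comment> \<open>Beyond index \<open>i\<close> the inner vertices are skipped: index
    \<open>i + 1\<close> of \<open>B\<close> is index \<open>j\<close> of \<open>cs\<close>.\<close>
  define B where "B = map (\<lambda>k. cs ! (if k \<le> i then k else k + c)) [0..<Suc (i + r)]"
  have len: "length A = Suc (Suc c)" "length B = Suc (i + r)" by (auto simp: A_def B_def)
  have nthA: "A ! k = cs ! (i + k)" if "k < Suc (Suc c)" for k
    unfolding A_def using that by (subst nth_map_upt) auto
  have nthB: "B ! k = cs ! (if k \<le> i then k else k + c)" if "k < Suc (i + r)" for k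
    unfolding B_def using that by (subst nth_map_upt) auto
  have alt': "cpair cs k \<in> pairs V U" "cpair cs k \<in> E \<longleftrightarrow> even k = s" if "k < n" for k
    using alt that by (auto simp: alt_cycle_def n)
  have cs: "distinct cs" using alt by (simp add: alt_cycle_def)
  have cpair_cs: "cpair cs k = {cs ! k, cs ! (if Suc k = n then 0 else Suc k)}" if "k < n" for k
    using that cpair_eq[of k cs] by (simp add: n)
  have cA: "cpair A k = cpair cs (i + k)" if "k < Suc c" for k
  proof -
    have "i + k < n" "Suc (i + k) \<noteq> n" using that r(2) by (auto simp: n_def)
    then show ?thesis using that by (simp add: cpair_eq[of k A] len nthA cpair_cs)
  qed
  have cA_last: "cpair A (Suc c) = e"
    by (simp add: cpair_eq[of "Suc c" A] len nthA e_def c(1) insert_commute)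
  have cB_less: "cpair B k = cpair cs k" if "k < i" for k
  proof -
    have "k < n" "Suc k \<noteq> n" using that r(2) by (auto simp: n_def)
    then show ?thesis using that by (simp add: cpair_eq[of k B] len nthB cpair_cs)
  qed
  have cB_i: "cpair B i = e"
    using r(2) by (simp add: cpair_eq[of i B] len nthB e_def c(1))
  have cB_greater: "cpair B k = cpair cs (k + c)" if "i < k" "k < Suc (i + r)" for k
  proof -
    have "k + c < n" "Suc (k + c) = n \<longleftrightarrow> k = i + r" using that by (auto simp: n_def)
    then show ?thesis using that by (simp add: cpair_eq[of k B] len nthB cpair_cs)
  qed
  have "inj_on ((!) cs) {..<n}" using cs by (intro inj_on_nth) (auto simp: n)
  then have nth_eq: "cs ! k = cs ! m \<longleftrightarrow> k = m" if "k < n" "m < n" for k m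
    using that by (auto simp: inj_on_def)
  have dist: "distinct A" "distinct B"
    using r(2) by (auto simp: distinct_conv_nth len nthA nthB nth_eq n_def)
  have e_pairs: "e \<in> pairs V U"
    using alt_cycle_chord_in_pairs[OF assms(2) alt, of i j] r(1,2) c by (auto simp: e_def)
  have e_chord: "e \<noteq> cpair cs k" if "k < n" for k
  proof -
    have "i < n" "j < n" using r(2) c by (auto simp: n_def)
    then show ?thesis
      using that r(2,3) c by (auto simp: cpair_cs e_def doubleton_eq_iff nth_eq n_def)
  qed
  \<comment> \<open>The edge set \<open>E'\<close> is left open, since it will be \<open>E\<close>
    or \<open>E\<close> after the swap of the other cycle. The chord sits at the odd index
    \<open>Suc c\<close> of \<open>A\<close>, but at index \<open>i\<close> of \<open>B\<close>,
    which gives opposite conditions on it.\<close>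
  have altA: "alt_cycle V U (s = even i) E' A"
    if "\<And>k. i \<le> k \<Longrightarrow> k < j \<Longrightarrow> cpair cs k \<in> E' \<longleftrightarrow> cpair cs k \<in> E" "e \<in> E' \<longleftrightarrow> even i \<noteq> s" for E'
    unfolding alt_cycle_def
  proof (intro conjI allI impI)
    fix k assume "k < length A"
    then consider "k = Suc c" | "k < Suc c" by (auto simp: len less_Suc_eq)
    then have "cpair A k \<in> pairs V U \<and> (cpair A k \<in> E' \<longleftrightarrow> even k = (s = even i))"
    proof cases
      case 1
      then show ?thesis using that(2) e_pairs c(2) by (auto simp: cA_last)
    next
      case 2
      then have "i + k < n" "i + k < j" by (auto simp: n_def c(1))
      then show ?thesis using that(1)[of "i + k"] alt'[of "i + k"] 2 by (auto simp: cA)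
    qed
    then show "cpair A k \<in> pairs V U" "cpair A k \<in> E' \<longleftrightarrow> even k = (s = even i)" by auto
  qed (use len c dist in auto)
  have altB: "alt_cycle V U s E' B"
    if "\<And>k. k < i \<or> j \<le> k \<Longrightarrow> k < n \<Longrightarrow> cpair cs k \<in> E' \<longleftrightarrow> cpair cs k \<in> E"
      "e \<in> E' \<longleftrightarrow> even i = s" for E'
    unfolding alt_cycle_def
  proof (intro conjI allI impI)
    fix k assume "k < length B"
    then consider "k < i" | "k = i" | "i < k" "k < Suc (i + r)" unfolding len by linarith
    then have "cpair B k \<in> pairs V U \<and> (cpair B k \<in> E' \<longleftrightarrow> even k = s)"
    proof cases
      case 1
      then show ?thesis using that(1)[of k] alt'[of k] by (simp add: cB_less n_def)
    next
      case 2
      then show ?thesis using that(2) e_pairs by (auto simp: cB_i)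
    next
      case 3
      then have "k + c < n" "j \<le> k + c" by (auto simp: n_def c(1))
      then show ?thesis
        using that(1)[of "k + c"] alt'[of "k + c"] c(2) by (auto simp: cB_greater[OF 3])
    qed
    then show "cpair B k \<in> pairs V U" "cpair B k \<in> E' \<longleftrightarrow> even k = s" by auto
  next
    show "even (length B)" "4 \<le> length B" using even_len c(2) r(3) by (auto simp: len)
  qed (use dist in auto)
  have pA: "cycle_pairs A = insert e (cpair cs ` {i..<j})"
  proof -
    have "cpair A ` {..<Suc c} = cpair cs ` (+) i ` {..<Suc c}"
      unfolding image_image using cA by (intro image_cong) auto
    also have "(+) i ` {..<Suc c} = {i..<j}"
      by (simp only: c(1) lessThan_atLeast0 image_add_atLeastLessThan) (simp add: add.commute)
    finally show ?thesis using cA_last by (simp add: cycle_pairs_image len lessThan_Suc)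
  qed
  have pB: "cycle_pairs B = insert e (cpair cs ` ({..<i} \<union> {j..<n}))"
  proof -
    have "{..<length B} = {..<i} \<union> {i} \<union> {Suc i..<Suc (i + r)}" by (auto simp: len)
    then have "cycle_pairs B =
      cpair B ` {..<i} \<union> {cpair B i} \<union> cpair B ` {Suc i..<Suc (i + r)}"
      by (simp only: cycle_pairs_image image_Un image_insert image_empty)
    also have "cpair B ` {..<i} = cpair cs ` {..<i}"
      using cB_less by (intro image_cong) auto
    also have "cpair B ` {Suc i..<Suc (i + r)} = cpair cs ` (\<lambda>k. k + c) ` {Suc i..<Suc (i + r)}"
      unfolding image_image using cB_greater by (intro image_cong) auto
    also have "(\<lambda>k. k + c) ` {Suc i..<Suc (i + r)} = {j..<n}"
      unfolding image_add_atLeastLessThan' by (simp add: c(1) n_def ac_simps)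
    finally show ?thesis using cB_i by auto
  qed
  have "{..<n} = {i..<j} \<union> ({..<i} \<union> {j..<n})" by (auto simp: n_def c(1))
  then have pcs: "cycle_pairs cs = cpair cs ` {i..<j} \<union> cpair cs ` ({..<i} \<union> {j..<n})"
    by (simp only: cycle_pairs_image n image_Un)
  have "inj_on (cpair cs) {..<n}" using cpair_inj_on[OF cs] r n by (simp add: c)
  then have disj: "cpair cs ` {i..<j} \<inter> cpair cs ` ({..<i} \<union> {j..<n}) = {}"
    by (subst inj_on_image_Int[symmetric]) (auto simp: n_def c(1))
  have e_notin: "e \<notin> cycle_pairs cs" using e_chord by (auto simp: cycle_pairs_image n)
  \<comment> \<open>The arcs are disjoint and share only the chord, which cancels in the symmetric
    difference.\<close>
  have sym: "sym_diff (cycle_pairs A) (cycle_pairs B) = cycle_pairs cs"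
    "cycle_pairs A \<union> cycle_pairs B = insert e (cycle_pairs cs)"
    using disj e_notin unfolding pA pB pcs by blast+
  \<comment> \<open>The status of the chord decides the order: in the first case \<open>B\<close> is
    swapped first, in the second \<open>A\<close>.\<close>
  show ?thesis
  proof (cases "e \<in> E \<longleftrightarrow> even i = s")
    case True
    have "cpair cs k \<notin> cycle_pairs B" if "i \<le> k" "k < j" for k
    proof -
      have "k < n" "cpair cs k \<in> cpair cs ` {i..<j}" using that by (auto simp: n_def c(1))
      then show ?thesis using disj e_chord[of k] unfolding pB by blast
    qed
    then have "alt_cycle V U (s = even i) (sym_diff E (cycle_pairs B)) A"
      using True by (intro altA) (auto simp: pB)
    moreover have "alt_cycle V U s E B" using True by (intro altB) auto
    ultimately show ?thesis
      using that[of s B "s = even i" A] len c r sym by (simp add: e_def Un_commute)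
  next
    case False
    have "cpair cs k \<notin> cycle_pairs A" if "k < i \<or> j \<le> k" "k < n" for k
    proof -
      have "cpair cs k \<in> cpair cs ` ({..<i} \<union> {j..<n})" using that by auto
      then show ?thesis using disj e_chord[OF that(2)] unfolding pA by blast
    qed
    then have "alt_cycle V U s (sym_diff E (cycle_pairs A)) B"
      using False by (intro altB) (auto simp: pA)
    moreover have "alt_cycle V U (s = even i) E A" using False by (intro altA) auto
    ultimately show ?thesis
      using that[of "s = even i" A s B] len c r sym by (simp add: e_def)
  qed
qed

section \<open>Sequences of short swaps\<close>

text \<open>As a relation, swaps can be chained and counted by relation powers; requiring both ends
  to be realisations carries this property along the chain.\<close>

definition swap_step ::
  "'a list \<Rightarrow> 'a list \<Rightarrow> nat list \<Rightarrow> nat list \<Rightarrow> 'a set set \<Rightarrow> 'a set set \<Rightarrow> nat \<Rightarrow>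
    ('a set set \<times> 'a set set) set" where
  "swap_step vs us a b F\<^sub>E F\<^sub>N l = {(E, E').
     realisation vs us a b F\<^sub>E F\<^sub>N E \<and> realisation vs us a b F\<^sub>E F\<^sub>N E' \<and>
     card (sym_diff E E') \<le> 2 * l - 2 \<and>
     (\<exists>j\<le>2 * l - 2. corresponds_to_swap (set vs) (set us) j E (sym_diff E E'))}"

text \<open>Strong induction on the length. The bound adds up under splitting: from
  \<open>2 * p + 2\<close> and \<open>2 * q + 2\<close> at most the lengths of the parts, whose sum
  is \<open>length cs + 2\<close>, it follows that \<open>2 * (p + q) + 2\<close> is at most
  \<open>length cs\<close>.\<close>

lemma alt_cycle_swap_steps:
  assumes disj: "set vs \<inter> set us = {}" and l: "4 \<le> l"
    and no_cycle: "\<nexists>cs. cycle_in (F\<^sub>E \<union> F\<^sub>N) cs \<and> length cs = 2 * l"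
    and "realisation vs us a b F\<^sub>E F\<^sub>N E" "alt_cycle (set vs) (set us) s E cs"
    and "cycle_pairs cs \<inter> (F\<^sub>E \<union> F\<^sub>N) = {}"
  shows "\<exists>n. 2 * n + 2 \<le> length cs \<and>
    (E, sym_diff E (cycle_pairs cs)) \<in> swap_step vs us a b F\<^sub>E F\<^sub>N l ^^ n"
  using assms(4-6)
proof (induction "length cs" arbitrary: cs E s rule: less_induct)
  case less
  let ?F = "F\<^sub>E \<union> F\<^sub>N" and ?E' = "sym_diff E (cycle_pairs cs)"
  have cs: "even (length cs)" "4 \<le> length cs" "distinct cs"
    using less.prems(2) by (auto simp: alt_cycle_def)
  show ?case
  proof (cases "length cs \<le> 2 * l - 2")
    case True
    have "sym_diff E ?E' = cycle_pairs cs" by auto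
    moreover have "card (cycle_pairs cs) = length cs" using card_cycle_pairs[OF cs(3)] cs(2) by simp
    ultimately have "(E, ?E') \<in> swap_step vs us a b F\<^sub>E F\<^sub>N l"
      using True less.prems realisation_swap[OF less.prems]
        alternating_cycle_if_alt_cycle[OF less.prems(2)]
      by (auto simp: swap_step_def corresponds_to_swap_def)
    then show ?thesis using cs by (intro exI[of _ 1]) auto
  next
    case False
    then have "2 * l \<le> length cs" using cs(1) l by presburger
    \<comment> \<open>If all these chords were in \<open>?F\<close>, then
      \<open>chords_cycle\<close> would give a cycle of length \<open>2 * l\<close> there.\<close>
    then obtain i j where ij: "i < j" "j < length cs" "odd (j - i)" "3 \<le> j - i"
        "j - i + 3 \<le> length cs" and chord: "{cs ! i, cs ! j} \<notin> ?F"
      using chords_cycle[of cs l ?F] cs(3) l no_cycle by blast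
    obtain A B s\<^sub>A s\<^sub>B where
      alt: "alt_cycle (set vs) (set us) s\<^sub>A E A"
        "alt_cycle (set vs) (set us) s\<^sub>B (sym_diff E (cycle_pairs A)) B" and
      len: "length A < length cs" "length B < length cs" "length A + length B = length cs + 2" and
      un: "cycle_pairs A \<union> cycle_pairs B = insert {cs ! i, cs ! j} (cycle_pairs cs)" and
      sym: "sym_diff (cycle_pairs A) (cycle_pairs B) = cycle_pairs cs"
      using split_alt_cycle[OF less.prems(2) disj ij] by metis
    have "(cycle_pairs A \<union> cycle_pairs B) \<inter> ?F = {}"
      unfolding un using chord less.prems(3) by auto
    then have F: "cycle_pairs A \<inter> ?F = {}" "cycle_pairs B \<inter> ?F = {}" by blast+
    let ?E1 = "sym_diff E (cycle_pairs A)"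
    obtain p where p: "2 * p + 2 \<le> length A" "(E, ?E1) \<in> swap_step vs us a b F\<^sub>E F\<^sub>N l ^^ p"
      using less.hyps[OF len(1) less.prems(1) alt(1) F(1)] by blast
    obtain q where q: "2 * q + 2 \<le> length B"
        "(?E1, sym_diff ?E1 (cycle_pairs B)) \<in> swap_step vs us a b F\<^sub>E F\<^sub>N l ^^ q"
      using less.hyps[OF len(2) realisation_swap[OF less.prems(1) alt(1) F(1)] alt(2) F(2)] by blast
    have "sym_diff ?E1 (cycle_pairs B) = ?E'" unfolding sym[symmetric] by blast
    then have "(E, ?E') \<in> swap_step vs us a b F\<^sub>E F\<^sub>N l ^^ (p + q)"
      using p q by (auto simp: relpow_add)
    then show ?thesis using p q len by (intro exI[of _ "p + q"]) auto
  qed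
qed

text \<open>Swapping one alternating cycle inside the symmetric difference removes exactly its pairs
  from it, so induction on the size of the difference applies and the costs add up.\<close>

lemma realisation_swap_steps:
  assumes disj: "set vs \<inter> set us = {}" and l: "4 \<le> l"
    and no_cycle: "\<nexists>cs. cycle_in (F\<^sub>E \<union> F\<^sub>N) cs \<and> length cs = 2 * l"
    and "realisation vs us a b F\<^sub>E F\<^sub>N G" "realisation vs us a b F\<^sub>E F\<^sub>N G'" "G \<noteq> G'"
  shows "\<exists>n. 2 * n + 2 \<le> card (sym_diff G G') \<and>
    (G, G') \<in> swap_step vs us a b F\<^sub>E F\<^sub>N l ^^ n"
  using assms(4-6)
proof (induction "card (sym_diff G G')" arbitrary: G rule: less_induct)
  case less
  let ?R = "swap_step vs us a b F\<^sub>E F\<^sub>N l" and ?D = "sym_diff G G'"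
  have sub: "G \<subseteq> pairs (set vs) (set us)" "G' \<subseteq> pairs (set vs) (set us)"
    using less.prems by (auto simp: realisation_def)
  then have fin: "finite ?D"
    by (meson finite_Diff finite_UnI finite_pairs finite_set finite_subset)
  have "degree G x = degree G' x" if "x \<in> set vs \<union> set us" for x
    using that less.prems unfolding realisation_def Un_iff in_set_conv_nth by metis
  then obtain s cs where alt: "alt_cycle (set vs) (set us) s G cs" and cD: "cycle_pairs cs \<subseteq> ?D"
    using alt_cycle_in_sym_diff[OF disj _ _ sub less.prems(3)] by blast
  have F: "cycle_pairs cs \<inter> (F\<^sub>E \<union> F\<^sub>N) = {}"
    using cD less.prems by (auto simp: realisation_def)
  let ?G1 = "sym_diff G (cycle_pairs cs)"
  have len: "4 \<le> length cs" "card (cycle_pairs cs) = length cs"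
    using alt card_cycle_pairs[of cs] by (auto simp: alt_cycle_def)
  obtain p where p: "2 * p + 2 \<le> length cs" "(G, ?G1) \<in> ?R ^^ p"
    using alt_cycle_swap_steps[OF disj l no_cycle less.prems(1) alt F] by blast
  have D1: "sym_diff ?G1 G' = ?D - cycle_pairs cs" using cD by blast
  have card: "card ?D = card (sym_diff ?G1 G') + length cs"
    unfolding D1 len(2)[symmetric] using cD fin
    by (metis card_Diff_subset card_mono finite_subset le_add_diff_inverse2)
  show ?case
  proof (cases "?G1 = G'")
    case True
    then show ?thesis using p card by auto
  next
    case False
    have "card (sym_diff ?G1 G') < card ?D" using card len(1) by linarith
    then obtain q where q: "2 * q + 2 \<le> card (sym_diff ?G1 G')" "(?G1, G') \<in> ?R ^^ q"
      using less.hyps[of ?G1] realisation_swap[OF less.prems(1) alt F] less.prems(2) False by blast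
    have "(G, G') \<in> ?R ^^ (p + q)" using p q by (auto simp: relpow_add)
    moreover have "2 * (p + q) + 2 \<le> m + k" if "2 * p + 2 \<le> k" "2 * q + 2 \<le> m" for m k :: nat
      using that by simp
    then have "2 * (p + q) + 2 \<le> card ?D" unfolding card using p(1) q(1) .
    ultimately show ?thesis by blast
  qed
qed

theorem theorem3:
  fixes vs us :: "'a list" and a b :: "nat list" and l :: nat
    and F F\<^sub>E F\<^sub>N G G' :: "'a set set"
  assumes "distinct (vs @ us)"
    and "length a = length vs" and "length b = length us"
    and "\<forall>x\<in>set a. 0 < x" and "\<forall>x\<in>set b. 0 < x"
    and "4 \<le> l"
    and "F\<^sub>E \<subseteq> pairs (set vs) (set us)" and "F\<^sub>N \<subseteq> pairs (set vs) (set us)"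
    and "F = F\<^sub>E \<union> F\<^sub>N"
    and "\<not> (\<exists>cs. cycle_in F cs \<and> length cs = 2 * l)"
    and "realisation vs us a b F\<^sub>E F\<^sub>N G" and "realisation vs us a b F\<^sub>E F\<^sub>N G'"
    and "G \<noteq> G'"
  shows "\<exists>(k::nat) H. 1 \<le> k \<and> H 1 = G \<and> H k = G' \<and>
    (\<forall>i\<in>{1..k}. realisation vs us a b F\<^sub>E F\<^sub>N (H i)) \<and>
    (\<forall>i\<in>{1..<k}. card (sym_diff (H i) (H (i + 1))) \<le> 2 * l - 2 \<and>
       (\<exists>j\<le>2 * l - 2. corresponds_to_swap (set vs) (set us) j (H i)
          (sym_diff (H i) (H (i + 1))))) \<and>
    real k \<le> 1 / 2 * real (card (sym_diff G G'))"
proof -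
  have "set vs \<inter> set us = {}" using assms(1) by auto
  then obtain n where n: "2 * n + 2 \<le> card (sym_diff G G')"
      "(G, G') \<in> swap_step vs us a b F\<^sub>E F\<^sub>N l ^^ n"
    using realisation_swap_steps assms(6,9-13) by metis
  then obtain f where f: "f 0 = G" "f n = G'"
      "\<And>i. i < n \<Longrightarrow> (f i, f (Suc i)) \<in> swap_step vs us a b F\<^sub>E F\<^sub>N l"
    by (auto simp: relpow_fun_conv)
  \<comment> \<open>The last element has no outgoing step, so it is covered by the hypothesis on
    \<open>G'\<close>.\<close>
  have real: "realisation vs us a b F\<^sub>E F\<^sub>N (f i)" if "i \<le> n" for i
    using that f assms(12) by (cases "i = n") (auto simp: swap_step_def)
  show ?thesis
  \<comment> \<open>A chain of \<open>n\<close> steps visits \<open>n + 1\<close> realisations; the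
    shift by one accounts for counting from 1 instead of 0.\<close>
  proof (rule exI[of _ "n + 1"], rule exI[of _ "\<lambda>i. f (i - 1)"], intro conjI ballI)
    fix i assume i: "i \<in> {1..<n + 1}"
    then have "(f (i - 1), f (i + 1 - 1)) \<in> swap_step vs us a b F\<^sub>E F\<^sub>N l"
      using f(3)[of "i - 1"] by auto
    then show "card (sym_diff (f (i - 1)) (f (i + 1 - 1))) \<le> 2 * l - 2"
      "\<exists>j\<le>2 * l - 2. corresponds_to_swap (set vs) (set us) j (f (i - 1))
        (sym_diff (f (i - 1)) (f (i + 1 - 1)))"
      by (auto simp only: swap_step_def mem_Collect_eq prod.case)
  next
    have "2 * (n + 1) \<le> card (sym_diff G G')" using n(1) by simp
    then have "real (2 * (n + 1)) \<le> real (card (sym_diff G G'))" by (rule of_nat_mono)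
    then show "real (n + 1) \<le> 1 / 2 * real (card (sym_diff G G'))" by simp
  qed (use f real in auto)
qed

end
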